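(* Let $(W,S)$ be a Coxeter system with $S$ finite. Let $X\subseteq W$ with $e\in X$ and let $\mathscr{P}=\mathscr{C}(X)$ be the (necessarily gated) conical partition induced by $X$. Then $\Gamma(\mathscr{P})$ is a Garside shadow if and only if $\mathscr{P}$ is regular.
   Context: $\ell$ is the length function, $e$ the identity, $D_L(w)=\{s\in S\mid\ell(sw)=\ell(w)-1\}$, and $x\preccurlyeq y$ means $\ell(x^{-1}y)=\ell(y)-\ell(x)$ (right weak order, for which every bounded subset $X$ has a least upper bound $\bigvee X$). An element $u$ is a suffix of $w$ if $\ell(w)=\ell(wu^{-1})+\ell(u)$. For $x\in W$, $C(x)=\{v\in W\mid x\preccurlyeq v\}$. The conical partition $\mathscr{C}(X)$ is the partition of $W$ in which $u,v$ lie in the same part iff for all $x\in X$: $u\in C(x)\Leftrightarrow v\in C(x)$. A partition is gated if each part $P$ contains an element $g$ (its gate, necessarily unique) with $g\preccurlyeq w$ for all $w\in P$; $\Gamma(\mathscr{P})$ is the set of gates of the parts of $\mathscr{P}$. (Every conical partition is gated.) A partition $\mathscr{P}$ is regular if $D_L$ is constant on each part $P$ (common value $D_L(P)$) and, for each part $P$ and $s\in S\setminus D_L(P)$, $sP\subseteq P'$ for some part $P'\in\mathscr{P}$. $B\subseteq W$ is a Garside shadow if $S\subseteq B$, $B$ contains $\bigvee Y$ for every $Y\subseteq B$ bounded in $(W,\preccurlyeq)$, and $B$ contains all suffixes of its elements. *)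

theory Defs
  imports "HOL-Algebra.Generated_Groups" "HOL-Algebra.Lattice"
    "HOL-Library.Extended_Nat" "HOL-Library.Disjoint_Sets"
begin

definition coxeter_matrix :: "'a set \<Rightarrow> ('a \<Rightarrow> 'a \<Rightarrow> enat) \<Rightarrow> bool" where
  "coxeter_matrix S m \<longleftrightarrow>
     (\<forall>s\<in>S. m s s = 1) \<and>
     (\<forall>s\<in>S. \<forall>t\<in>S. m s t = m t s) \<and>
     (\<forall>s\<in>S. \<forall>t\<in>S. s \<noteq> t \<longrightarrow> m s t \<ge> 2)"

(* The congruence on words over S generated by (st)^m(s,t) = 1 for m(s,t) finite.  As
   m(s,s) = 1, the relators ss make every letter its own inverse, so that this monoid
   presentation defines the same group as the group presentation. *)
inductive coxeter_equiv :: "'a set \<Rightarrow> ('a \<Rightarrow> 'a \<Rightarrow> enat) \<Rightarrow> 'a list \<Rightarrow> 'a list \<Rightarrow> bool"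
  for S m where
  relator: "\<lbrakk>s \<in> S; t \<in> S; m s t = enat k; u \<in> lists S; v \<in> lists S\<rbrakk>
     \<Longrightarrow> coxeter_equiv S m (u @ concat (replicate k [s, t]) @ v) (u @ v)"
| refl: "u \<in> lists S \<Longrightarrow> coxeter_equiv S m u u"
| sym: "coxeter_equiv S m u v \<Longrightarrow> coxeter_equiv S m v u"
| trans: "\<lbrakk>coxeter_equiv S m u v; coxeter_equiv S m v w\<rbrakk> \<Longrightarrow> coxeter_equiv S m u w"

definition word_prod :: "('a, 'b) monoid_scheme \<Rightarrow> 'a list \<Rightarrow> 'a" where
  "word_prod G u = foldr (\<otimes>\<^bsub>G\<^esub>) u \<one>\<^bsub>G\<^esub>"

locale coxeter_system = group G for G (structure) +
  fixes S :: "'a set"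
  assumes generators: "S \<subseteq> carrier G"
    and generating: "generate G S = carrier G"
    and presentation: "\<exists>m. coxeter_matrix S m \<and>
      (\<forall>u\<in>lists S. \<forall>v\<in>lists S. word_prod G u = word_prod G v \<longleftrightarrow> coxeter_equiv S m u v)"

definition word_length :: "('a, 'b) monoid_scheme \<Rightarrow> 'a set \<Rightarrow> 'a \<Rightarrow> nat" where
  "word_length G S w = (LEAST n. \<exists>u\<in>lists S. length u = n \<and> word_prod G u = w)"

definition left_descents :: "('a, 'b) monoid_scheme \<Rightarrow> 'a set \<Rightarrow> 'a \<Rightarrow> 'a set" where
  "left_descents G S w = {s \<in> S. word_length G S (s \<otimes>\<^bsub>G\<^esub> w) + 1 = word_length G S w}"

definition right_weak_le :: "('a, 'b) monoid_scheme \<Rightarrow> 'a set \<Rightarrow> 'a \<Rightarrow> 'a \<Rightarrow> bool" where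
  "right_weak_le G S x y \<longleftrightarrow>
     word_length G S x + word_length G S (inv\<^bsub>G\<^esub> x \<otimes>\<^bsub>G\<^esub> y) = word_length G S y"

definition right_weak_order :: "('a, 'b) monoid_scheme \<Rightarrow> 'a set \<Rightarrow> 'a gorder" where
  "right_weak_order G S = \<lparr>carrier = carrier G, eq = (=), le = right_weak_le G S\<rparr>"

definition is_suffix :: "('a, 'b) monoid_scheme \<Rightarrow> 'a set \<Rightarrow> 'a \<Rightarrow> 'a \<Rightarrow> bool" where
  "is_suffix G S u w \<longleftrightarrow>
     word_length G S w = word_length G S (w \<otimes>\<^bsub>G\<^esub> inv\<^bsub>G\<^esub> u) + word_length G S u"

definition cone :: "('a, 'b) monoid_scheme \<Rightarrow> 'a set \<Rightarrow> 'a \<Rightarrow> 'a set" where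
  "cone G S x = {v \<in> carrier G. right_weak_le G S x v}"

definition conical_partition :: "('a, 'b) monoid_scheme \<Rightarrow> 'a set \<Rightarrow> 'a set \<Rightarrow> 'a set set" where
  "conical_partition G S X = carrier G //
     {(u, v). u \<in> carrier G \<and> v \<in> carrier G \<and> (\<forall>x\<in>X. u \<in> cone G S x \<longleftrightarrow> v \<in> cone G S x)}"

definition is_gate :: "('a, 'b) monoid_scheme \<Rightarrow> 'a set \<Rightarrow> 'a set \<Rightarrow> 'a \<Rightarrow> bool" where
  "is_gate G S P g \<longleftrightarrow> g \<in> P \<and> (\<forall>w\<in>P. right_weak_le G S g w)"

definition gates :: "('a, 'b) monoid_scheme \<Rightarrow> 'a set \<Rightarrow> 'a set set \<Rightarrow> 'a set" where
  "gates G S \<P> = {g. \<exists>P\<in>\<P>. is_gate G S P g}"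

(* D is the common value D_L(P); it is unique since the parts of a partition are nonempty. *)
definition regular_partition :: "('a, 'b) monoid_scheme \<Rightarrow> 'a set \<Rightarrow> 'a set set \<Rightarrow> bool" where
  "regular_partition G S \<P> \<longleftrightarrow> partition_on (carrier G) \<P> \<and>
     (\<forall>P\<in>\<P>. \<exists>D. (\<forall>w\<in>P. left_descents G S w = D) \<and>
        (\<forall>s\<in>S - D. \<exists>P'\<in>\<P>. s <#\<^bsub>G\<^esub> P \<subseteq> P'))"

definition garside_shadow :: "('a, 'b) monoid_scheme \<Rightarrow> 'a set \<Rightarrow> 'a set \<Rightarrow> bool" where
  "garside_shadow G S B \<longleftrightarrow>
     B \<subseteq> carrier G \<and> S \<subseteq> B \<and>
     (\<forall>Y\<subseteq>B. Upper (right_weak_order G S) Y \<noteq> {} \<longrightarrow> \<Squnion>\<^bsub>right_weak_order G S\<^esub> Y \<in> B) \<and>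
     (\<forall>w\<in>B. \<forall>u\<in>carrier G. is_suffix G S u w \<longrightarrow> u \<in> B)"

end

theory Submission
  imports Defs
begin

text \<open>A gate of \<open>\<C>(X)\<close> is an element \<open>g\<close> that is the join of the \<open>x \<in> X\<close> below it, so \<open>\<Gamma>\<close> and \<open>X\<close> induce
  the same partition. If \<open>\<Gamma>\<close> is a Garside shadow, \<open>s\<close> is not a descent of the part of \<open>u\<close>, and a gate
  \<open>y\<close> lies below \<open>su\<close>, then after replacing \<open>y\<close> by its join with \<open>s\<close> the suffix \<open>sy\<close> is a gate below
  \<open>u\<close>, hence below every \<open>v\<close> in the same part, and \<open>y\<close> is below \<open>sv\<close>. Conversely, if the partition is
  regular, \<open>w = sv\<close> is a gate with \<open>\<ell>(w) = \<ell>(v) + 1\<close> and \<open>g\<close> is the gate of the part of \<open>v\<close>, then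
  \<open>sg\<close> lies in the part of \<open>w\<close> and is no longer than \<open>w\<close>, which forces \<open>g = v\<close>.

  Joins of bounded sets come from the exchange condition: if \<open>zs\<close> and \<open>zt\<close> cover \<open>z\<close> and have common
  upper bounds, then some common upper bound of \<open>zs\<close> and \<open>zt\<close> lies below all of them. By induction,
  sets of lower bounds are directed, so meets of nonempty sets exist.\<close>

context coxeter_system
begin

section \<open>Words, their products and the length function\<close>

abbreviation wp :: "'a list \<Rightarrow> 'a" where "wp \<equiv> word_prod G"
abbreviation len :: "'a \<Rightarrow> nat" where "len \<equiv> word_length G S"
abbreviation weak_le :: "'a \<Rightarrow> 'a \<Rightarrow> bool" (infix "\<preceq>" 50) where
  "x \<preceq> y \<equiv> right_weak_le G S x y"

lemma gen_closed [simp]: "s \<in> S \<Longrightarrow> s \<in> carrier G"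
  using generators by blast

lemma inv_mult_cancel [simp]:
  "\<lbrakk>x \<in> carrier G; y \<in> carrier G\<rbrakk> \<Longrightarrow> inv x \<otimes> (x \<otimes> y) = y"
  "\<lbrakk>x \<in> carrier G; y \<in> carrier G\<rbrakk> \<Longrightarrow> x \<otimes> (inv x \<otimes> y) = y"
  by (simp_all flip: m_assoc)

lemma wp_Nil [simp]: "wp [] = \<one>"
  and wp_Cons [simp]: "wp (a # u) = a \<otimes> wp u"
  by (simp_all add: word_prod_def)

lemma wp_closed [simp]: "u \<in> lists S \<Longrightarrow> wp u \<in> carrier G"
  by (induction u) auto

lemma wp_append [simp]:
  "\<lbrakk>u \<in> lists S; v \<in> lists S\<rbrakk> \<Longrightarrow> wp (u @ v) = wp u \<otimes> wp v"
  by (induction u) (auto simp: m_assoc)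

text \<open>The diagonal entry \<open>m s s = 1\<close> makes \<open>[s, s]\<close> itself a
  relator.\<close>

lemma gen_square [simp]:
  assumes "s \<in> S" shows "s \<otimes> s = \<one>"
proof -
  obtain m where m: "coxeter_matrix S m"
    "\<forall>u\<in>lists S. \<forall>v\<in>lists S. wp u = wp v \<longleftrightarrow> coxeter_equiv S m u v"
    using presentation by auto
  have "m s s = enat 1"
    using m(1) assms by (simp add: coxeter_matrix_def one_enat_def)
  then have "coxeter_equiv S m [s, s] []"
    using coxeter_equiv.relator[of s S s m 1 "[]" "[]"] assms by simp
  then have "wp [s, s] = wp []" using bspec[OF bspec[OF m(2)], of "[s, s]" "[]"] assms by simp
  then show ?thesis using assms by simp
qed

lemma inv_gen [simp]: "s \<in> S \<Longrightarrow> inv s = s"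
  by (simp add: inv_equality)

lemma gen_gen_mult [simp]: "\<lbrakk>s \<in> S; y \<in> carrier G\<rbrakk> \<Longrightarrow> s \<otimes> (s \<otimes> y) = y"
  by (simp flip: m_assoc)

lemma rev_in_lists [simp]: "rev u \<in> lists S \<longleftrightarrow> u \<in> lists S"
  by (simp add: in_lists_conv_set)

lemma wp_rev: "u \<in> lists S \<Longrightarrow> wp (rev u) = inv (wp u)"
  by (induction u) (simp_all add: inv_mult_group)

lemma wp_surj:
  assumes "w \<in> carrier G" obtains u where "u \<in> lists S" "wp u = w"
proof -
  have "w \<in> generate G S" using assms generating by simp
  then have "\<exists>u\<in>lists S. wp u = w"
  proof induction
    case one
    show ?case by (rule bexI[of _ "[]"]) auto
  next
    case (incl h)
    then show ?case by (intro bexI[of _ "[h]"]) auto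
  next
    case (inv h)
    \<comment> \<open>Generators are involutions, so \<open>[h]\<close> represents
      \<open>inv h\<close> as well.\<close>
    then show ?case by (intro bexI[of _ "[h]"]) auto
  next
    case (eng h1 h2)
    then obtain u v where "u \<in> lists S" "wp u = h1" "v \<in> lists S" "wp v = h2" by blast
    then show ?case by (intro bexI[of _ "u @ v"]) auto
  qed
  then show ?thesis using that by blast
qed

lemma obtain_reduced_word:
  assumes "w \<in> carrier G" obtains u where "u \<in> lists S" "length u = len w" "wp u = w"
proof -
  obtain u where "u \<in> lists S" "wp u = w" using wp_surj[OF assms] .
  then have "\<exists>n. \<exists>u\<in>lists S. length u = n \<and> wp u = w" by blast
  then have "\<exists>u\<in>lists S. length u = len w \<and> wp u = w"
    unfolding word_length_def by (rule LeastI_ex)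
  then show ?thesis using that by blast
qed

lemma len_wp_le: "u \<in> lists S \<Longrightarrow> len (wp u) \<le> length u"
  unfolding word_length_def by (rule Least_le) blast

lemma len_one [simp]: "len \<one> = 0"
  using len_wp_le[of "[]"] by simp

lemma len_eq_0_iff: "w \<in> carrier G \<Longrightarrow> len w = 0 \<longleftrightarrow> w = \<one>"
  by (metis obtain_reduced_word length_0_conv wp_Nil len_one)

lemma len_mult_le:
  assumes "x \<in> carrier G" "y \<in> carrier G" shows "len (x \<otimes> y) \<le> len x + len y"
proof -
  obtain u v where "u \<in> lists S" "length u = len x" "wp u = x"
    "v \<in> lists S" "length v = len y" "wp v = y"
    using assms obtain_reduced_word by metis
  then show ?thesis using len_wp_le[of "u @ v"] by auto
qed

lemma len_inv [simp]:
  assumes "x \<in> carrier G" shows "len (inv x) = len x"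
proof -
  have *: "len (inv y) \<le> len y" if y: "y \<in> carrier G" for y
  proof -
    obtain u where "u \<in> lists S" "length u = len y" "wp u = y"
      using obtain_reduced_word[OF y] .
    then show ?thesis using len_wp_le[of "rev u"] wp_rev[of u] by simp
  qed
  show ?thesis using *[OF assms] *[of "inv x"] assms by simp
qed

text \<open>Every relator has even length \<open>2 * k\<close>, so parity survives each step of the
  congruence.\<close>

lemma even_length_cong:
  assumes "u \<in> lists S" "v \<in> lists S" "wp u = wp v"
  shows "even (length u) = even (length v)"
proof -
  obtain m where m: "coxeter_matrix S m"
    "\<forall>u\<in>lists S. \<forall>v\<in>lists S. wp u = wp v \<longleftrightarrow> coxeter_equiv S m u v"
    using presentation by auto
  from bspec[OF bspec[OF m(2) assms(1)] assms(2)] have "coxeter_equiv S m u v" using assms(3) by simp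
  then show ?thesis
  proof induction
    case (relator s t k u v)
    have "length (concat (replicate k [s, t])) = 2 * k" by (induction k) auto
    then show ?case by simp
  qed auto
qed

lemma even_len_wp: "u \<in> lists S \<Longrightarrow> even (len (wp u)) = even (length u)"
  by (metis obtain_reduced_word even_length_cong wp_closed)

text \<open>Parity rules out length 0, so no generator is trivial.\<close>

lemma len_gen [simp]: "s \<in> S \<Longrightarrow> len s = 1"
  using even_len_wp[of "[s]"] len_wp_le[of "[s]"] by (auto simp: le_Suc_eq)

text \<open>Subadditivity limits the change to at most one, and parity excludes equality.\<close>

lemma len_gen_mult:
  assumes "s \<in> S" "w \<in> carrier G"
  shows "len (s \<otimes> w) = len w + 1 \<or> len (s \<otimes> w) + 1 = len w"
proof -
  obtain u where u: "u \<in> lists S" "length u = len w" "wp u = w"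
    using obtain_reduced_word[OF assms(2)] .
  have "even (len (s \<otimes> w)) \<noteq> even (len w)"
    using even_len_wp[of "s # u"] u assms by auto
  moreover have "len (s \<otimes> w) \<le> len w + 1"
    using len_mult_le[of s w] assms by simp
  moreover have "len w \<le> len (s \<otimes> w) + 1"
    using len_mult_le[of s "s \<otimes> w"] assms by simp
  ultimately show ?thesis
    by (metis Suc_eq_plus1 le_SucE le_antisym)
qed

subsection \<open>The exchange condition\<close>

definition conjug :: "'a \<Rightarrow> 'a \<Rightarrow> 'a" where "conjug g x = g \<otimes> x \<otimes> inv g"

text \<open>For a word \<open>s\<^sub>1 \<dots> s\<^sub>k\<close>, the list of the reflections
  \<open>(s\<^sub>1 \<dots> s\<^bsub>i-1\<^esub>) s\<^sub>i (s\<^sub>1 \<dots> s\<^bsub>i-1\<^esub>)\<^sup>-\<^sup>1\<close>.\<close>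

fun refls :: "'a list \<Rightarrow> 'a list" where
  "refls [] = []"
| "refls (a # u) = a # map (conjug a) (refls u)"

lemma conjug_closed [simp]: "\<lbrakk>g \<in> carrier G; x \<in> carrier G\<rbrakk> \<Longrightarrow> conjug g x \<in> carrier G"
  by (simp add: conjug_def)

lemma conjug_mult:
  "\<lbrakk>g \<in> carrier G; h \<in> carrier G; x \<in> carrier G\<rbrakk> \<Longrightarrow> conjug (g \<otimes> h) x = conjug g (conjug h x)"
  by (simp add: conjug_def inv_mult_group m_assoc)

lemma conjug_one [simp]: "x \<in> carrier G \<Longrightarrow> conjug \<one> x = x"
  by (simp add: conjug_def)

lemma refls_closed: "u \<in> lists S \<Longrightarrow> set (refls u) \<subseteq> carrier G"
  by (induction u) auto

lemma refls_append:
  "\<lbrakk>u \<in> lists S; v \<in> lists S\<rbrakk> \<Longrightarrow> refls (u @ v) = refls u @ map (conjug (wp u)) (refls v)"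
proof (induction u)
  case Nil
  then show ?case using refls_closed[of v] by (auto intro!: map_idI[symmetric])
next
  case (Cons a u)
  then show ?case using refls_closed[of v] by (auto simp: conjug_mult subset_iff)
qed

text \<open>If \<open>u = p @ a # q\<close>, left multiplication by the conjugate of
  \<open>a\<close> by \<open>wp p\<close> cancels the letter \<open>a\<close> and leaves
  \<open>p @ q\<close>.\<close>

lemma in_refls_delete:
  assumes "u \<in> lists S" "r \<in> set (refls u)"
  shows "\<exists>p a q. u = p @ a # q \<and> r \<otimes> wp u = wp (p @ q)"
  using assms
proof (induction u arbitrary: r rule: list.induct)
  case (Cons b u)
  show ?case
  proof (cases "r = b")
    case True
    then show ?thesis using Cons.prems by (metis append_Nil gen_gen_mult listsE wp_Cons wp_closed)
  next
    case False
    then obtain r' where r': "r' \<in> set (refls u)" "r = conjug b r'" using Cons.prems by auto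
    moreover have "u \<in> lists S" "b \<in> S" using Cons.prems by auto
    ultimately obtain p a q where u: "u = p @ a # q" "r' \<otimes> wp u = wp (p @ q)"
      using Cons.IH by blast
    have "r' \<in> carrier G" using r' \<open>u \<in> lists S\<close> refls_closed by blast
    then have "r \<otimes> wp (b # u) = b \<otimes> (r' \<otimes> wp u)"
      using r' \<open>u \<in> lists S\<close> \<open>b \<in> S\<close> by (simp add: conjug_def m_assoc)
    then have "r \<otimes> wp (b # u) = wp ((b # p) @ q)" using u by simp
    then show ?thesis using u(1) by (intro exI[of _ "b # p"] exI[of _ a] exI[of _ q]) simp
  qed
qed simp

text \<open>Conjugation by the head \<open>a\<close> fixes \<open>a\<close>. If \<open>a\<close>
  recurred, it would therefore be a reflection of the tail \<open>u\<close>, and deleting a letter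
  of \<open>u\<close> would represent \<open>a \<otimes> wp u\<close> by a word that is too
  short.\<close>

lemma distinct_refls:
  assumes "u \<in> lists S" "length u = len (wp u)" shows "distinct (refls u)"
  using assms
proof (induction u rule: list.induct)
  case (Cons a u)
  have au: "a \<in> S" "u \<in> lists S" using Cons.prems by auto
  have "len (wp (a # u)) \<le> 1 + len (wp u)" using len_mult_le[of a "wp u"] au by simp
  then have "length u = len (wp u)" using Cons.prems(2) len_wp_le[OF au(2)] by simp
  then have "distinct (refls u)" using Cons.IH au by blast
  moreover have inj: "x = y" if "conjug a x = conjug a y" "x \<in> carrier G" "y \<in> carrier G" for x y
    using that au by (simp add: conjug_def)
  ultimately have "distinct (map (conjug a) (refls u))"
    using refls_closed[OF au(2)] by (auto simp: distinct_map inj_on_def)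
  moreover have "a \<notin> conjug a ` set (refls u)"
  proof
    assume "a \<in> conjug a ` set (refls u)"
    then obtain x where x: "x \<in> set (refls u)" "conjug a x = a" by force
    have "conjug a a = a" using au by (simp add: conjug_def)
    then have "x = a" using inj[of x a] x au refls_closed[OF au(2)] by auto
    then obtain p b q where u: "u = p @ b # q" "a \<otimes> wp u = wp (p @ q)"
      using in_refls_delete x au by blast
    then have "len (wp (a # u)) \<le> length (p @ q)"
      using len_wp_le[of "p @ q"] au by simp
    then show False using Cons.prems(2) u by simp
  qed
  ultimately show ?case by simp
qed simp

text \<open>The involution \<open>s\<close> inverts \<open>s \<otimes> t\<close>, so every conjugate
  that arises collapses to a power of \<open>s \<otimes> t\<close> times \<open>s\<close>.\<close>

lemma refls_relator:
  assumes st: "s \<in> S" "t \<in> S"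
  shows "wp (concat (replicate k [s, t])) = (s \<otimes> t) [^] k \<and>
    refls (concat (replicate k [s, t])) = map (\<lambda>i. (s \<otimes> t) [^] i \<otimes> s) [0..<2*k]"
proof (induction k)
  case (Suc k)
  let ?r = "concat (replicate k [s, t])"
  have r: "?r \<in> lists S" using st by (induction k) auto
  have e: "concat (replicate (Suc k) [s, t]) = ?r @ [s, t]"
    by (simp flip: replicate_append_same)
  have s_pow: "s \<otimes> inv ((s \<otimes> t) [^] n) = (s \<otimes> t) [^] n \<otimes> s" for n :: nat
  proof (induction n)
    case (Suc n)
    have "s \<otimes> inv ((s \<otimes> t) [^] Suc n) = s \<otimes> (t \<otimes> s) \<otimes> inv ((s \<otimes> t) [^] n)"
      using st by (simp add: inv_mult_group m_assoc)
    also have "\<dots> = (s \<otimes> t) \<otimes> (s \<otimes> inv ((s \<otimes> t) [^] n))" using st by (simp add: m_assoc)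
    also have "\<dots> = (s \<otimes> t) [^] Suc n \<otimes> s"
      unfolding nat_pow_Suc2[OF m_closed[OF gen_closed gen_closed, OF st]]
      using st Suc by (simp add: m_assoc)
    finally show ?case .
  qed (use st in simp)
  \<comment> \<open>The appended block \<open>[s, t]\<close> contributes exactly the exponents
    \<open>2 * k\<close> and \<open>2 * k + 1\<close>.\<close>
  have c1: "conjug ((s \<otimes> t) [^] k) s = (s \<otimes> t) [^] (2 * k) \<otimes> s"
    using st s_pow[of k] by (simp add: conjug_def m_assoc mult_2 flip: nat_pow_mult)
  have "conjug ((s \<otimes> t) [^] k) (conjug s t)
      = (s \<otimes> t) [^] k \<otimes> ((s \<otimes> t) \<otimes> (s \<otimes> inv ((s \<otimes> t) [^] k)))"
    using st by (simp add: conjug_def m_assoc)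
  also have "\<dots> = (s \<otimes> t) [^] k \<otimes> (s \<otimes> t) \<otimes> (s \<otimes> t) [^] k \<otimes> s"
    unfolding s_pow using st by (simp add: m_assoc)
  also have "(s \<otimes> t) [^] k \<otimes> (s \<otimes> t) \<otimes> (s \<otimes> t) [^] k = (s \<otimes> t) [^] Suc (2 * k)"
    using st nat_pow_mult[of "s \<otimes> t" "Suc k" k] by (simp add: mult_2)
  finally have c2: "conjug ((s \<otimes> t) [^] k) (conjug s t) = (s \<otimes> t) [^] Suc (2 * k) \<otimes> s" .
  show ?case
    unfolding e using Suc st r c1 c2 by (simp add: refls_append)
qed simp

text \<open>For a relator, the \<open>k\<close>-th power of \<open>s \<otimes> t\<close> is trivial,
  so its list of \<open>2 * k\<close> reflections is a list of length \<open>k\<close> repeated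
  twice and adds an even count. As its product is \<open>\<one>\<close>, the reflections coming from
  the following letters do not change.\<close>

lemma even_count_refls_cong:
  assumes "u \<in> lists S" "v \<in> lists S" "wp u = wp v"
  shows "even (count_list (refls u) r) = even (count_list (refls v) r)"
proof -
  obtain m where m: "coxeter_matrix S m"
    "\<forall>u\<in>lists S. \<forall>v\<in>lists S. wp u = wp v \<longleftrightarrow> coxeter_equiv S m u v"
    using presentation by auto
  from bspec[OF bspec[OF m(2) assms(1)] assms(2)] have "coxeter_equiv S m u v" using assms(3) by simp
  then show ?thesis
  proof induction
    case (relator s t k u v)
    let ?r = "concat (replicate k [s, t])" and ?f = "\<lambda>i. (s \<otimes> t) [^] i \<otimes> s"
    have r: "?r \<in> lists S" using relator(1,2) by (induction k) auto
    have "coxeter_equiv S m ?r []"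
      using coxeter_equiv.relator[of s S t m k "[]" "[]"] relator by simp
    then have r1: "wp ?r = \<one>" using bspec[OF bspec[OF m(2) r], of "[]"] by simp
    then have pow: "(s \<otimes> t) [^] k = \<one>" using refls_relator relator by metis
    have "?f (i + k) = ?f i" for i
      using pow relator by (simp flip: nat_pow_mult)
    then have "map ?f [k..<k + k] = map ?f [0..<k]"
      by (intro nth_equalityI) (auto simp: add.commute)
    then have "map ?f [0..<2 * k] = map ?f [0..<k] @ map ?f [0..<k]"
      by (simp add: mult_2 upt_add_eq_append[of 0])
    then have refls_r: "refls ?r = map ?f [0..<k] @ map ?f [0..<k]"
      using refls_relator relator by metis
    have "refls (u @ ?r @ v) =
        refls u @ map (conjug (wp u)) (refls ?r) @ map (conjug (wp u)) (refls v)"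
      using relator r r1 by (simp add: refls_append flip: append_assoc)
    then show ?case
      using relator unfolding refls_r by (simp add: refls_append) argo
  qed auto
qed

text \<open>The parity of the multiplicity of \<open>s\<close> among the reflections of a word depends only on the
  product; for the reduced word starting with \<open>s\<close> it is odd.\<close>

lemma exchange:
  assumes "u \<in> lists S" "s \<in> S" "len (s \<otimes> wp u) < len (wp u)"
  shows "\<exists>p a q. u = p @ a # q \<and> s \<otimes> wp u = wp (p @ q)"
proof -
  obtain v where v: "v \<in> lists S" "length v = len (s \<otimes> wp u)" "wp v = s \<otimes> wp u"
    using obtain_reduced_word[of "s \<otimes> wp u"] assms by auto
  have sv: "s # v \<in> lists S" "wp (s # v) = wp u" using v assms by auto
  have "length (s # v) = len (wp (s # v))"
    using len_gen_mult[of s "wp u"] assms v sv by auto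
  then have "distinct (refls (s # v))" using distinct_refls sv by blast
  then have "count_list (refls (s # v)) s = 1" by (simp add: count_list_0_iff)
  then have "odd (count_list (refls u) s)"
    using even_count_refls_cong[OF sv(1) assms(1) sv(2)] by (metis odd_one)
  then have "s \<in> set (refls u)" by (metis count_notin even_zero)
  then show ?thesis using in_refls_delete assms by blast
qed

subsection \<open>Weak order\<close>

lemma le_refl [simp]: "x \<in> carrier G \<Longrightarrow> x \<preceq> x"
  by (simp add: right_weak_le_def)

lemma one_le [simp]: "x \<in> carrier G \<Longrightarrow> \<one> \<preceq> x"
  by (simp add: right_weak_le_def)

lemma le_len: "x \<preceq> y \<Longrightarrow> len x \<le> len y"
  by (simp add: right_weak_le_def)

lemma le_len_eq:
  assumes "x \<preceq> y" "len y \<le> len x" "x \<in> carrier G" "y \<in> carrier G" shows "x = y"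
proof -
  have "len (inv x \<otimes> y) = 0" using assms unfolding right_weak_le_def by simp
  then have "inv x \<otimes> y = \<one>" using assms by (simp add: len_eq_0_iff)
  then show ?thesis using assms by (metis inv_mult_cancel(2) r_one)
qed

lemma le_antisym: "\<lbrakk>x \<preceq> y; y \<preceq> x; x \<in> carrier G; y \<in> carrier G\<rbrakk> \<Longrightarrow> x = y"
  using le_len le_len_eq by blast

lemma le_trans:
  assumes "x \<preceq> y" "y \<preceq> z" "x \<in> carrier G" "y \<in> carrier G" "z \<in> carrier G" shows "x \<preceq> z"
proof -
  have "inv x \<otimes> z = (inv x \<otimes> y) \<otimes> (inv y \<otimes> z)" using assms by (simp add: m_assoc)
  then have "len (inv x \<otimes> z) \<le> len (inv x \<otimes> y) + len (inv y \<otimes> z)"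
    using len_mult_le assms by simp
  moreover have "len z \<le> len x + len (inv x \<otimes> z)"
    using len_mult_le[of x "inv x \<otimes> z"] assms by simp
  ultimately show ?thesis using assms(1,2) unfolding right_weak_le_def by simp
qed

lemma le_mult_iff:
  "\<lbrakk>x \<in> carrier G; y \<in> carrier G\<rbrakk> \<Longrightarrow> x \<preceq> x \<otimes> y \<longleftrightarrow> len (x \<otimes> y) = len x + len y"
  by (auto simp: right_weak_le_def)

text \<open>Additivity of lengths for \<open>z \<otimes> b\<close> leaves no slack in the triangle
  inequalities through \<open>z \<otimes> d\<close>. Left translation by \<open>z\<close> thus
  preserves the order below \<open>b\<close>.\<close>

lemma mult_left_le:
  assumes "z \<preceq> z \<otimes> b" "d \<preceq> b" "z \<in> carrier G" "b \<in> carrier G" "d \<in> carrier G"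
  shows "z \<otimes> d \<preceq> z \<otimes> b \<and> z \<preceq> z \<otimes> d"
proof -
  have q: "inv (z \<otimes> d) \<otimes> (z \<otimes> b) = inv d \<otimes> b"
    using assms by (simp add: inv_mult_group m_assoc)
  have "len (z \<otimes> b) \<le> len (z \<otimes> d) + len (inv d \<otimes> b)"
    using len_mult_le[of "z \<otimes> d" "inv d \<otimes> b"] assms by (simp add: m_assoc)
  moreover have "len (z \<otimes> d) \<le> len z + len d" using len_mult_le assms by simp
  moreover have "len (z \<otimes> b) = len z + len b" using le_mult_iff assms by blast
  moreover have "len d + len (inv d \<otimes> b) = len b" using assms by (simp add: right_weak_le_def)
  ultimately show ?thesis using assms by (auto simp: right_weak_le_def q)
qed

lemma mult_left_cancel_le:
  assumes "z \<preceq> z \<otimes> d" "z \<otimes> d \<preceq> z \<otimes> b" "z \<in> carrier G" "b \<in> carrier G" "d \<in> carrier G"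
  shows "d \<preceq> b"
proof -
  have q: "inv (z \<otimes> d) \<otimes> (z \<otimes> b) = inv d \<otimes> b"
    using assms by (simp add: inv_mult_group m_assoc)
  have "z \<preceq> z \<otimes> b" using le_trans[OF assms(1,2)] assms by simp
  then show ?thesis using assms by (simp add: le_mult_iff right_weak_le_def q)
qed

lemma gen_le_iff: "\<lbrakk>s \<in> S; w \<in> carrier G\<rbrakk> \<Longrightarrow> s \<preceq> w \<longleftrightarrow> s \<in> left_descents G S w"
  by (auto simp: right_weak_le_def left_descents_def)

lemma gen_le_mult_iff: "\<lbrakk>s \<in> S; w \<in> carrier G\<rbrakk> \<Longrightarrow> s \<preceq> s \<otimes> w \<longleftrightarrow> \<not> s \<preceq> w"
  using len_gen_mult[of s w] by (auto simp: right_weak_le_def)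

text \<open>The first letter of a reduced word for \<open>inv z \<otimes> a\<close> gives the first
  step of a chain of covers from \<open>z\<close> up to \<open>a\<close>.\<close>

lemma obtain_le_gen:
  assumes "z \<preceq> a" "z \<noteq> a" "z \<in> carrier G" "a \<in> carrier G"
  obtains s where "s \<in> S" "z \<preceq> z \<otimes> s" "z \<otimes> s \<preceq> a"
proof -
  let ?b = "inv z \<otimes> a"
  obtain u where u: "u \<in> lists S" "length u = len ?b" "wp u = ?b"
    using obtain_reduced_word[of ?b] assms by auto
  have "?b \<noteq> \<one>" using assms by (metis inv_mult_cancel(2) r_one)
  then obtain s v where sv: "u = s # v" using u by (cases u) auto
  then have s: "s \<in> S" "v \<in> lists S" using u by auto
  have "s \<otimes> ?b = wp v" using s by (simp flip: u(3) add: sv)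
  then have "len (s \<otimes> ?b) < len ?b" using len_wp_le[OF s(2)] u sv by simp
  then have "s \<preceq> ?b" using len_gen_mult[of s ?b] s assms by (auto simp: right_weak_le_def)
  then have "z \<otimes> s \<preceq> z \<otimes> ?b \<and> z \<preceq> z \<otimes> s" using mult_left_le[of z ?b s] assms s by simp
  then show ?thesis using that s assms by simp
qed

section \<open>Alternating words and elements with two given descents\<close>

fun alt :: "nat \<Rightarrow> 'a \<Rightarrow> 'a \<Rightarrow> 'a list" where
  "alt 0 s t = []"
| "alt (Suc k) s t = s # alt k t s"

lemma length_alt [simp]: "length (alt k s t) = k"
  by (induction k arbitrary: s t) auto

lemma alt_in_lists [simp]: "\<lbrakk>s \<in> S; t \<in> S\<rbrakk> \<Longrightarrow> alt k s t \<in> lists S"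
  by (induction k arbitrary: s t) auto

lemma butlast_alt: "butlast (alt (Suc k) s t) = alt k s t"
  by (induction k arbitrary: s t) auto

text \<open>The two neighbours of an interior letter of an alternating word agree, so deleting that
  letter puts equal letters side by side.\<close>

lemma alt_split:
  assumes "alt k s t = p @ a # q"
  shows "p = [] \<or> q = [] \<or> (\<exists>p' c q'. p = p' @ [c] \<and> q = c # q')"
  using assms
proof (induction p arbitrary: k s t)
  case (Cons x p)
  then obtain k' where k': "k = Suc k'" "x = s" "alt k' t s = p @ a # q" by (cases k) auto
  show ?case
  proof (cases "p = []")
    case True
    then obtain k'' where "k' = Suc k''" "q = alt k'' s t" using k' by (cases k') auto
    then show ?thesis using True k' by (cases k'') auto
  next
    case False
    then have "q = [] \<or> (\<exists>p' c q'. p = p' @ [c] \<and> q = c # q')" using Cons.IH[OF k'(3)] by simp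
    then show ?thesis by (metis append_Cons)
  qed
qed simp

text \<open>Some reduced word of \<open>b\<close> starts with \<open>alt k s t\<close>. As
  \<open>t\<close> is a descent of \<open>b\<close>, exchange deletes a letter of that word.
  Deletions inside the alternating prefix are impossible, so \<open>t\<close> can be put in front of
  the whole prefix.\<close>

lemma alt_step:
  assumes st: "s \<in> S" "t \<in> S" "s \<noteq> t" and b: "b \<in> carrier G"
    and red: "len (wp (alt k s t)) = k" and le: "wp (alt k s t) \<preceq> b" and tb: "t \<preceq> b"
    and ne: "wp (alt k s t) \<noteq> wp (alt k t s)"
  shows "wp (alt (Suc k) t s) \<preceq> b \<and> len (wp (alt (Suc k) t s)) = Suc k"
proof -
  let ?a = "wp (alt k s t)"
  have ac: "?a \<in> carrier G" using st by simp
  obtain v where v: "v \<in> lists S" "length v = len (inv ?a \<otimes> b)" "wp v = inv ?a \<otimes> b"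
    using obtain_reduced_word[of "inv ?a \<otimes> b"] ac b by auto
  have bv: "wp (alt k s t @ v) = b" using v st ac b by simp
  have lb: "len b = k + length v" using le red v by (simp add: right_weak_le_def)
  have "len (t \<otimes> b) < len b" using tb st by (simp add: right_weak_le_def)
  then obtain p x q where pq: "alt k s t @ v = p @ x # q" "t \<otimes> b = wp (p @ q)"
    using exchange[of "alt k s t @ v" t] v st unfolding bv by auto
  have pqS: "p @ x # q \<in> lists S" using v(1) st by (simp flip: pq(1))
  from pq(1) consider (right) p' where "p = alt k s t @ p'" "v = p' @ x # q"
    | (left) q' where "alt k s t = p @ x # q'" "q = q' @ v"
    by (auto simp: append_eq_append_conv2 Cons_eq_append_conv append_eq_Cons_conv)
  then show ?thesis
  proof cases
    case right
    \<comment> \<open>The deleted letter lies in \<open>v\<close>: the prefix grows by one letter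
      and the rest shrinks by one, so the length count forces equality everywhere.\<close>
    let ?w = "wp (p' @ q)"
    have wS: "p' @ q \<in> lists S" using right v by simp
    then have "t \<otimes> b = ?a \<otimes> ?w" using pq(2) right st by (simp add: m_assoc)
    then have "b = t \<otimes> (?a \<otimes> ?w)" using st b by (metis gen_gen_mult)
    then have beq: "b = wp (alt (Suc k) t s) \<otimes> ?w" using st wS by (simp add: m_assoc)
    have "len ?w \<le> length v - 1" using len_wp_le[OF wS] right by simp
    moreover have "length v \<ge> 1" using right by simp
    moreover have "len (wp (alt (Suc k) t s)) \<le> Suc k"
      using len_wp_le[of "alt (Suc k) t s"] st by (simp del: alt.simps)
    moreover have "len b \<le> len (wp (alt (Suc k) t s)) + len ?w"
      using beq len_mult_le[of "wp (alt (Suc k) t s)" ?w] wS st by (simp del: alt.simps)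
    ultimately have "len (wp (alt (Suc k) t s)) = Suc k"
      "len b = len (wp (alt (Suc k) t s)) + len ?w"
      using lb by linarith+
    then show ?thesis
      using beq wS st le_mult_iff[of "wp (alt (Suc k) t s)" ?w] by (simp del: alt.simps)
  next
    case left
    have pS: "p \<in> lists S" "q' \<in> lists S" using pqS left by auto
    have "t \<otimes> ?a \<otimes> wp v = t \<otimes> b" using v st ac b by (simp add: m_assoc)
    also have "\<dots> = wp (p @ q') \<otimes> wp v" using pq(2) left pS v(1) by (simp add: m_assoc)
    finally have "t \<otimes> ?a \<otimes> wp v = wp (p @ q') \<otimes> wp v" .
    then have ta: "t \<otimes> ?a = wp (p @ q')" using pS v(1) st by simp
    have k: "k = Suc (length p + length q')"
      using arg_cong[OF left(1), of length] by simp
    consider "p = []" | "q' = []" | p' c q'' where "p = p' @ [c]" "q' = c # q''"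
      using alt_split[OF left(1)] by blast
    then have False
    proof cases
      case 1
      \<comment> \<open>Deleting the first letter would give
        \<open>t \<otimes> s = \<one>\<close>.\<close>
      then have "x = s" using left(1) k by auto
      then have "?a = s \<otimes> wp q'" using left(1) 1 by simp
      then have "t \<otimes> s \<otimes> wp q' = wp q'" using ta 1 st pS by (simp add: m_assoc)
      then have "t \<otimes> s = \<one>" using st pS by simp
      then have "s = t" using st by (metis gen_closed inv_equality inv_gen)
      then show False using st by simp
    next
      case 2
      \<comment> \<open>Deleting the last letter would identify the two alternating products of
        length \<open>k\<close>, against \<open>ne\<close>.\<close>
      then have "p = alt (length p) s t"
        using left(1) k butlast_alt[of "length p" s t] by (metis add_0_right butlast_snoc list.size(3))
      then have "t \<otimes> ?a = wp (alt (length p) s t)" using ta 2 by simp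
      then have "?a = t \<otimes> wp (alt (length p) s t)" using ac st by (metis gen_gen_mult)
      then show False using ne k 2 by simp
    next
      case 3
      \<comment> \<open>Deleting an interior letter makes its neighbours cancel, which leaves length
        at most \<open>k - 3\<close>, whereas \<open>t\<close> lowers the length by at most
        one.\<close>
      then have "wp (p @ q') = wp (p' @ q'')" using pS by (auto simp: m_assoc)
      moreover have "p' @ q'' \<in> lists S" using 3 pS by auto
      ultimately have "len (t \<otimes> ?a) + 2 < k"
        using len_wp_le[of "p' @ q''"] ta k 3 by simp
      then show False using len_gen_mult[of t ?a] st ac red by auto
    qed
    then show ?thesis ..
  qed
qed

text \<open>While the alternating products starting with \<open>s\<close> and with \<open>t\<close>
  differ, \<open>alt_step\<close> extends both below every member of \<open>B\<close>. Lengths bound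
  this process, so the two must coincide at some point. The common product depends only on
  \<open>s\<close> and \<open>t\<close> until then, so one \<open>d\<close> serves all of
  \<open>B\<close>.\<close>

lemma two_descents:
  assumes st: "s \<in> S" "t \<in> S" "s \<noteq> t" and B: "B \<subseteq> carrier G" "B \<noteq> {}"
    and le: "\<And>b. b \<in> B \<Longrightarrow> s \<preceq> b \<and> t \<preceq> b"
  shows "\<exists>d\<in>carrier G. s \<preceq> d \<and> t \<preceq> d \<and> (\<forall>b\<in>B. d \<preceq> b)"
proof (rule ccontr)
  assume no: "\<not> ?thesis"
  have "len (wp (alt (Suc k) s t)) = Suc k \<and> len (wp (alt (Suc k) t s)) = Suc k \<and>
    (\<forall>b\<in>B. wp (alt (Suc k) s t) \<preceq> b \<and> wp (alt (Suc k) t s) \<preceq> b)" for k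
  proof (induction k)
    case 0
    then show ?case using le st by simp
  next
    case (Suc k)
    have gle: "x \<preceq> wp (alt (Suc k) x y)" if "x \<in> S" "y \<in> S"
      "len (wp (alt (Suc k) x y)) = Suc k" for x y
    proof -
      have "len (wp (alt k y x)) \<le> k" using len_wp_le[of "alt k y x"] that by simp
      then show ?thesis using that len_gen_mult[of x "wp (alt k y x)"]
        by (auto simp: le_mult_iff)
    qed
    \<comment> \<open>A common product would be an admissible \<open>d\<close>, since both of its
      words are reduced.\<close>
    have ne: "wp (alt (Suc k) s t) \<noteq> wp (alt (Suc k) t s)"
    proof
      let ?d = "wp (alt (Suc k) s t)"
      assume eq: "?d = wp (alt (Suc k) t s)"
      have "s \<preceq> ?d" using gle[of s t] st Suc by blast
      moreover have "t \<preceq> ?d" unfolding eq using gle[of t s] st Suc by blast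
      moreover have "?d \<in> carrier G" using st by simp
      ultimately show False using no Suc by blast
    qed
    have "wp (alt (Suc (Suc k)) t s) \<preceq> b \<and> len (wp (alt (Suc (Suc k)) t s)) = Suc (Suc k)"
      "wp (alt (Suc (Suc k)) s t) \<preceq> b \<and> len (wp (alt (Suc (Suc k)) s t)) = Suc (Suc k)"
      if b: "b \<in> B" for b
    proof -
      have bc: "b \<in> carrier G" using b B by blast
      show "wp (alt (Suc (Suc k)) t s) \<preceq> b \<and> len (wp (alt (Suc (Suc k)) t s)) = Suc (Suc k)"
        by (rule alt_step) (use st bc b Suc ne le in blast)+
      show "wp (alt (Suc (Suc k)) s t) \<preceq> b \<and> len (wp (alt (Suc (Suc k)) s t)) = Suc (Suc k)"
        by (rule alt_step) (use st bc b Suc ne[symmetric] le in blast)+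
    qed
    then show ?case using B(2) by blast
  qed
  moreover obtain b where "b \<in> B" using B(2) by blast
  ultimately have "Suc (len b) \<le> len b" using le_len by metis
  then show False by simp
qed

section \<open>Meets and joins in the weak order\<close>

lemma lower_bounds_directed:
  assumes A: "A \<subseteq> carrier G" "A \<noteq> {}"
    and z: "z \<in> carrier G" and a: "a \<in> carrier G" "\<And>x. x \<in> A \<Longrightarrow> a \<preceq> x"
    and c: "c \<in> carrier G" "\<And>x. x \<in> A \<Longrightarrow> c \<preceq> x" and za: "z \<preceq> a" and zc: "z \<preceq> c"
  shows "\<exists>h\<in>carrier G. (\<forall>x\<in>A. h \<preceq> x) \<and> a \<preceq> h \<and> c \<preceq> h"
proof -
  obtain x0 where x0: "x0 \<in> A" using A by blast
  show ?thesis using z a c za zc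
  \<comment> \<open>This is a confluence argument: \<open>z\<close> climbs through covers but stays
    below \<open>x0\<close>, so its distance to \<open>x0\<close> decreases.\<close>
  proof (induction "len x0 - len z" arbitrary: z a c rule: less_induct)
    case less
    note z = less.prems(1) and a = less.prems(2,3) and c = less.prems(4,5)
    have tr: "u \<preceq> x" if "u \<preceq> y" "y \<preceq> x" "x \<in> A" "u \<in> carrier G" "y \<in> carrier G" for u x y
      using le_trans that A by blast
    show ?case
    proof (cases "z = a \<or> z = c")
      case True
      then show ?thesis using less.prems le_refl by blast
    next
      case False
      obtain s where s: "s \<in> S" "z \<preceq> z \<otimes> s" "z \<otimes> s \<preceq> a"
        using obtain_le_gen[of z a] False less.prems by blast
      obtain t where t: "t \<in> S" "z \<preceq> z \<otimes> t" "z \<otimes> t \<preceq> c"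
        using obtain_le_gen[of z c] False less.prems by blast
      have dec: "len x0 - len (z \<otimes> r) < len x0 - len z"
        if "r \<in> S" "z \<preceq> z \<otimes> r" "z \<otimes> r \<preceq> x0" for r
        using that le_len[OF that(3)] z by (simp add: le_mult_iff)
      have sx: "z \<otimes> s \<preceq> x" and tx: "z \<otimes> t \<preceq> x" and zx: "z \<preceq> x" if "x \<in> A" for x
        using tr[OF s(3) a(2)] tr[OF t(3) c(2)] tr[OF less.prems(6) a(2)] that z s t a c by simp_all
      show ?thesis
      proof (cases "s = t")
        case True
        then show ?thesis
          using less.hyps[OF dec[OF s(1,2) sx[OF x0]], of a c] s t a c z by simp
      next
        case False
        \<comment> \<open>Translation by \<open>inv z\<close> turns the two covers of
          \<open>z\<close> into generators, as \<open>two_descents\<close> requires.\<close>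
        let ?B = "(\<lambda>x. inv z \<otimes> x) ` A"
        have "?B \<subseteq> carrier G" "?B \<noteq> {}" using A z by auto
        moreover have "s \<preceq> b \<and> t \<preceq> b" if "b \<in> ?B" for b
        proof -
          obtain x where x: "x \<in> A" "b = inv z \<otimes> x" using \<open>b \<in> ?B\<close> by blast
          then show ?thesis
            using mult_left_cancel_le[of z s b] mult_left_cancel_le[of z t b] sx tx s t z A by auto
        qed
        ultimately obtain d where d: "d \<in> carrier G" "s \<preceq> d" "t \<preceq> d" "\<And>b. b \<in> ?B \<Longrightarrow> d \<preceq> b"
          using two_descents[OF s(1) t(1) False] by metis
        have zd: "z \<otimes> d \<preceq> x \<and> z \<preceq> z \<otimes> d" if "x \<in> A" for x
        proof -
          have "x \<in> carrier G" using A that by auto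
          then show ?thesis
            using mult_left_le[of z "inv z \<otimes> x" d] d that zx[OF that] z by auto
        qed
        have zz: "z \<preceq> z \<otimes> d" using zd x0 by blast
        have sd: "z \<otimes> s \<preceq> z \<otimes> d" and td: "z \<otimes> t \<preceq> z \<otimes> d"
          using mult_left_le[of z d s] mult_left_le[of z d t] d s t z zz by auto
        \<comment> \<open>Closing the diamond in two steps: \<open>f\<close> bounds \<open>a\<close>
          and \<open>z \<otimes> d\<close> with base \<open>z \<otimes> s\<close>, then
          \<open>h\<close> bounds \<open>f\<close> and \<open>c\<close> with base
          \<open>z \<otimes> t\<close>.\<close>
        obtain f where f: "f \<in> carrier G" "\<And>x. x \<in> A \<Longrightarrow> f \<preceq> x" "a \<preceq> f" "z \<otimes> d \<preceq> f"
          using less.hyps[OF dec[OF s(1,2) sx[OF x0]], of a "z \<otimes> d"] s sd zd d a z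
          by (metis gen_closed m_closed)
        have "z \<otimes> t \<preceq> f" using le_trans[OF td f(4)] z t d f by simp
        then obtain h where h: "h \<in> carrier G" "\<And>x. x \<in> A \<Longrightarrow> h \<preceq> x" "f \<preceq> h" "c \<preceq> h"
          using less.hyps[OF dec[OF t(1,2) tx[OF x0]], of f c] t f c z
          by (metis gen_closed m_closed)
        moreover have "a \<preceq> h" using le_trans[OF f(3) h(3)] a f h by simp
        ultimately show ?thesis by blast
      qed
    qed
  qed
qed

text \<open>Lower bounds have length at most \<open>len x0\<close>, so a longest one exists.
  Directedness, applied with base \<open>\<one>\<close>, makes it the greatest.\<close>

lemma meet_exists:
  assumes A: "A \<subseteq> carrier G" "A \<noteq> {}"
  shows "\<exists>g\<in>carrier G. (\<forall>x\<in>A. g \<preceq> x) \<and>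
    (\<forall>c\<in>carrier G. (\<forall>x\<in>A. c \<preceq> x) \<longrightarrow> c \<preceq> g)"
proof -
  obtain x0 where x0: "x0 \<in> A" using A by blast
  let ?P = "\<lambda>g. g \<in> carrier G \<and> (\<forall>x\<in>A. g \<preceq> x)"
  have "?P \<one>" using A by auto
  moreover have "\<forall>g. ?P g \<longrightarrow> len g < Suc (len x0)"
    using le_len x0 by (metis le_imp_less_Suc)
  ultimately obtain g where g: "?P g" "\<And>c. ?P c \<Longrightarrow> len c \<le> len g"
    using ex_has_greatest_nat[of ?P \<one> len] by (metis less_imp_le)
  have "c \<preceq> g" if c: "?P c" for c
  proof -
    obtain h where h: "?P h" "g \<preceq> h" "c \<preceq> h"
      using lower_bounds_directed[of A \<one> g c] A g(1) c by auto
    then have "g = h" using le_len_eq g by blast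
    then show ?thesis using h by simp
  qed
  then show ?thesis using g by blast
qed

text \<open>A relation rather than a value: the library join is a choice term, which is informative
  only once existence and uniqueness are known.\<close>

definition lub :: "'a set \<Rightarrow> 'a \<Rightarrow> bool" where
  "lub Y j \<longleftrightarrow> j \<in> carrier G \<and> (\<forall>y\<in>Y. y \<preceq> j) \<and>
     (\<forall>u\<in>carrier G. (\<forall>y\<in>Y. y \<preceq> u) \<longrightarrow> j \<preceq> u)"

text \<open>The join is the meet of the set of upper bounds, which contains
  \<open>b\<close>.\<close>

lemma lub_exists:
  assumes Y: "Y \<subseteq> carrier G" and b: "b \<in> carrier G" "\<And>y. y \<in> Y \<Longrightarrow> y \<preceq> b"
  shows "\<exists>j. lub Y j"
proof -
  let ?U = "{u \<in> carrier G. \<forall>y\<in>Y. y \<preceq> u}"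
  have "?U \<subseteq> carrier G" "?U \<noteq> {}" using b by auto
  from meet_exists[OF this] obtain j where j: "j \<in> carrier G" "\<forall>u\<in>?U. j \<preceq> u"
    "\<forall>c\<in>carrier G. (\<forall>u\<in>?U. c \<preceq> u) \<longrightarrow> c \<preceq> j" by blast
  then have "lub Y j" unfolding lub_def using Y by blast
  then show ?thesis ..
qed

lemma lub_unique: "\<lbrakk>lub Y j; lub Y j'\<rbrakk> \<Longrightarrow> j = j'"
  unfolding lub_def using le_antisym by blast

lemma Upper_right_weak_order:
  "Y \<subseteq> carrier G \<Longrightarrow> Upper (right_weak_order G S) Y = {u \<in> carrier G. \<forall>y\<in>Y. y \<preceq> u}"
  by (auto simp: Upper_def right_weak_order_def)

lemma sup_right_weak_order:
  assumes "Y \<subseteq> carrier G" "lub Y j" shows "\<Squnion>\<^bsub>right_weak_order G S\<^esub> Y = j"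
proof -
  have "least (right_weak_order G S) x (Upper (right_weak_order G S) Y) \<longleftrightarrow> lub Y x" for x
    unfolding Upper_right_weak_order[OF assms(1)]
    by (auto simp: least_def lub_def right_weak_order_def)
  then show ?thesis unfolding sup_def using assms lub_unique by auto
qed

subsection \<open>Gates of conical partitions\<close>

definition same_part :: "'a set \<Rightarrow> 'a \<Rightarrow> 'a \<Rightarrow> bool" where
  "same_part X u v \<longleftrightarrow> u \<in> carrier G \<and> v \<in> carrier G \<and> (\<forall>x\<in>X. x \<preceq> u \<longleftrightarrow> x \<preceq> v)"

lemma conical_partition_eq:
  "conical_partition G S X = (\<lambda>u. {v. same_part X u v}) ` carrier G"
  by (auto simp: conical_partition_def quotient_def cone_def same_part_def)

lemma partition_on_conical_partition: "partition_on (carrier G) (conical_partition G S X)"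
  unfolding conical_partition_def
  by (rule partition_on_quotient) (auto simp: equiv_def refl_on_def sym_def trans_def)

text \<open>The join \<open>j\<close> of the elements of \<open>X\<close> below \<open>g\<close> is
  itself below \<open>g\<close>, and the same elements of \<open>X\<close> lie below it. Hence
  \<open>j\<close> is in the part of \<open>g\<close>, and minimality of a gate gives
  \<open>j = g\<close>. Conversely, such a join lies below every member of its part.\<close>

lemma gates_iff:
  assumes X: "X \<subseteq> carrier G"
  shows "g \<in> gates G S (conical_partition G S X) \<longleftrightarrow> lub {x \<in> X. x \<preceq> g} g" (is "?L \<longleftrightarrow> ?R")
proof
  assume ?L
  then obtain P where P: "P \<in> conical_partition G S X" "g \<in> P" "\<forall>w\<in>P. g \<preceq> w"
    unfolding gates_def is_gate_def by blast
  then obtain u where "P = {v. same_part X u v}" unfolding conical_partition_eq by blast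
  then have u: "same_part X u g" "\<And>w. same_part X u w \<Longrightarrow> g \<preceq> w" using P by simp_all
  have gc: "g \<in> carrier G" using u(1) by (simp add: same_part_def)
  have "\<exists>j. lub {x \<in> X. x \<preceq> g} j" by (rule lub_exists[OF _ gc]) (use X in auto)
  then obtain j where j: "lub {x \<in> X. x \<preceq> g} j" ..
  then have jc: "j \<in> carrier G" and jg: "j \<preceq> g" using gc by (auto simp: lub_def)
  have "x \<preceq> j \<longleftrightarrow> x \<preceq> g" if "x \<in> X" for x
  proof
    show "x \<preceq> g" if "x \<preceq> j" using le_trans[OF that jg _ jc gc] \<open>x \<in> X\<close> X by blast
    show "x \<preceq> j" if "x \<preceq> g" using that \<open>x \<in> X\<close> j by (simp add: lub_def)
  qed
  then have "same_part X u j" using u(1) jc by (simp add: same_part_def)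
  then have "j = g" using le_antisym[OF jg u(2) jc gc] by simp
  then show ?R using j by simp
next
  assume R: ?R
  then have "is_gate G S {v. same_part X g v} g"
    by (auto simp: is_gate_def lub_def same_part_def)
  moreover have "g \<in> carrier G" using R by (simp add: lub_def)
  ultimately show ?L unfolding gates_def conical_partition_eq by blast
qed

text \<open>Conical partitions are gated: the join of the elements of \<open>X\<close> below
  \<open>u\<close> is the gate of the part of \<open>u\<close>.\<close>

lemma obtain_gate:
  assumes X: "X \<subseteq> carrier G" and u: "u \<in> carrier G"
  obtains g where "g \<in> gates G S (conical_partition G S X)" "g \<preceq> u" "same_part X g u"
proof -
  have "\<exists>g. lub {x \<in> X. x \<preceq> u} g" by (rule lub_exists[OF _ u]) (use X in auto)
  then obtain g where g: "lub {x \<in> X. x \<preceq> u} g" ..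
  have gc: "g \<in> carrier G" and gu: "g \<preceq> u" using g u by (auto simp: lub_def)
  have eq: "x \<preceq> g \<longleftrightarrow> x \<preceq> u" if "x \<in> X" for x
  proof
    show "x \<preceq> u" if "x \<preceq> g" using le_trans[OF that gu _ gc u] \<open>x \<in> X\<close> X by blast
    show "x \<preceq> g" if "x \<preceq> u" using that \<open>x \<in> X\<close> g by (simp add: lub_def)
  qed
  then have "{x \<in> X. x \<preceq> g} = {x \<in> X. x \<preceq> u}" by blast
  then have "g \<in> gates G S (conical_partition G S X)" using g by (simp add: gates_iff[OF X])
  moreover have "same_part X g u" using eq gc u by (simp add: same_part_def)
  ultimately show ?thesis using gu that by blast
qed

text \<open>The elements of \<open>X\<close> below \<open>y\<close> are below \<open>v\<close> too,
  and \<open>y\<close> is their join. So gates separate no more than \<open>X\<close> does.\<close>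

lemma same_part_gate_le:
  assumes X: "X \<subseteq> carrier G" and y: "y \<in> gates G S (conical_partition G S X)"
    and uv: "same_part X u v" and yu: "y \<preceq> u"
  shows "y \<preceq> v"
proof -
  have l: "lub {x \<in> X. x \<preceq> y} y" using y gates_iff[OF X] by blast
  have "x \<preceq> v" if "x \<in> X" "x \<preceq> y" for x
    using le_trans[OF that(2) yu] that uv X l by (auto simp: same_part_def lub_def)
  then show ?thesis using l uv by (auto simp: lub_def same_part_def)
qed

lemma gates_subset: "X \<subseteq> carrier G \<Longrightarrow> gates G S (conical_partition G S X) \<subseteq> carrier G"
  by (auto simp: gates_iff lub_def)

lemma same_part_sym: "same_part X u v \<Longrightarrow> same_part X v u"
  by (auto simp: same_part_def)

text \<open>Regularity in terms of pairs in one part, the form in which both implications use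
  it.\<close>

lemma regular_conical_partition_iff:
  "regular_partition G S (conical_partition G S X) \<longleftrightarrow>
    (\<forall>u v. same_part X u v \<longrightarrow> left_descents G S u = left_descents G S v \<and>
      (\<forall>s\<in>S - left_descents G S u. same_part X (s \<otimes> u) (s \<otimes> v)))" (is "?L \<longleftrightarrow> ?R")
proof
  assume L: ?L
  show ?R
  proof (intro allI impI)
    fix u v assume uv: "same_part X u v"
    let ?P = "{w. same_part X u w}"
    have "u \<in> carrier G" using uv by (simp add: same_part_def)
    then have "?P \<in> conical_partition G S X" by (auto simp: conical_partition_eq)
    with conjunct2[OF L[unfolded regular_partition_def]]
    have "\<exists>D. (\<forall>w\<in>?P. left_descents G S w = D) \<and>
        (\<forall>s\<in>S - D. \<exists>P'\<in>conical_partition G S X. s <# ?P \<subseteq> P')" ..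
    then obtain D where D: "\<forall>w\<in>?P. left_descents G S w = D"
      "\<forall>s\<in>S - D. \<exists>P'\<in>conical_partition G S X. s <# ?P \<subseteq> P'" by (elim exE conjE)
    have P: "u \<in> ?P" "v \<in> ?P" using uv by (auto simp: same_part_def)
    then have Du: "left_descents G S u = D" "left_descents G S v = D" using D(1) by auto
    moreover have "same_part X (s \<otimes> u) (s \<otimes> v)" if s: "s \<in> S - D" for s
    proof -
      obtain P' where "P' \<in> conical_partition G S X" "s <# ?P \<subseteq> P'"
        using bspec[OF D(2) s] ..
      then obtain w where "s <# ?P \<subseteq> {v. same_part X w v}"
        unfolding conical_partition_eq by blast
      then have "same_part X w (s \<otimes> u)" "same_part X w (s \<otimes> v)"
        using P unfolding l_coset_def by auto
      then show ?thesis by (auto simp: same_part_def)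
    qed
    ultimately show "left_descents G S u = left_descents G S v \<and>
      (\<forall>s\<in>S - left_descents G S u. same_part X (s \<otimes> u) (s \<otimes> v))" by simp
  qed
next
  assume R: ?R
  have des: "left_descents G S u = left_descents G S v" if "same_part X u v" for u v
    by (rule R[THEN spec, THEN spec, THEN mp, OF that, THEN conjunct1])
  have mult: "same_part X (s \<otimes> u) (s \<otimes> v)"
    if "same_part X u v" "s \<in> S - left_descents G S u" for s u v
    by (rule R[THEN spec, THEN spec, THEN mp, OF that(1), THEN conjunct2, THEN bspec, OF that(2)])
  have "\<exists>D. (\<forall>w\<in>P. left_descents G S w = D) \<and>
      (\<forall>s\<in>S - D. \<exists>P'\<in>conical_partition G S X. s <# P \<subseteq> P')"
    if P: "P \<in> conical_partition G S X" for P
  proof -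
    obtain u where u: "u \<in> carrier G" "P = {w. same_part X u w}"
      using P unfolding conical_partition_eq by blast
    have "\<forall>w\<in>P. left_descents G S w = left_descents G S u"
      using des[symmetric] u by blast
    moreover have "\<exists>P'\<in>conical_partition G S X. s <# P \<subseteq> P'"
      if "s \<in> S - left_descents G S u" for s
    proof (rule bexI)
      show "s <# P \<subseteq> {w. same_part X (s \<otimes> u) w}" using mult u that unfolding l_coset_def by blast
      show "{w. same_part X (s \<otimes> u) w} \<in> conical_partition G S X"
        using u that by (auto simp: conical_partition_eq)
    qed
    ultimately show ?thesis by blast
  qed
  then show ?L
    unfolding regular_partition_def by (rule conjI[OF partition_on_conical_partition ballI])
qed

section \<open>The two implications between Garside shadows and regularity\<close>

lemma gen_mult_le:
  assumes "s \<in> S" "y \<in> carrier G" "u \<in> carrier G" "s \<preceq> y" "\<not> s \<preceq> u"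
  shows "y \<preceq> s \<otimes> u \<longleftrightarrow> s \<otimes> y \<preceq> u"
proof -
  have "s \<preceq> s \<otimes> u" using assms gen_le_mult_iff by blast
  \<comment> \<open>Both \<open>y\<close> and \<open>s \<otimes> u\<close> are now length-additive
    left translates by \<open>s\<close>, so the translation can be applied and cancelled.\<close>
  moreover have "s \<otimes> (s \<otimes> y) = y" using assms by simp
  ultimately show ?thesis
    using mult_left_le[of s u "s \<otimes> y"] mult_left_cancel_le[of s "s \<otimes> y" u] assms by auto
qed

lemma regular_if_garside_shadow:
  assumes X: "X \<subseteq> carrier G"
    and gs: "garside_shadow G S (gates G S (conical_partition G S X))"
  shows "regular_partition G S (conical_partition G S X)"
  unfolding regular_conical_partition_iff
proof (intro allI impI conjI ballI)
  let ?\<Gamma> = "gates G S (conical_partition G S X)"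
  have gen: "S \<subseteq> ?\<Gamma>"
    and sup: "\<And>Y. \<lbrakk>Y \<subseteq> ?\<Gamma>; Upper (right_weak_order G S) Y \<noteq> {}\<rbrakk> \<Longrightarrow>
      \<Squnion>\<^bsub>right_weak_order G S\<^esub> Y \<in> ?\<Gamma>"
    and suffix: "\<And>w u. \<lbrakk>w \<in> ?\<Gamma>; u \<in> carrier G; is_suffix G S u w\<rbrakk> \<Longrightarrow> u \<in> ?\<Gamma>"
    using gs unfolding garside_shadow_def by blast+
  \<comment> \<open>Generators are gates, hence membership in a part determines the
    descents.\<close>
  have le_iff: "s \<preceq> u \<longleftrightarrow> s \<preceq> v" if "same_part X u v" "s \<in> S" for u v s
    using that gen same_part_gate_le[OF X] same_part_sym by blast
  fix u v assume uv: "same_part X u v"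
  have uvc: "u \<in> carrier G" "v \<in> carrier G" using uv by (auto simp: same_part_def)
  show "left_descents G S u = left_descents G S v"
    using le_iff[OF uv] gen_le_iff uvc by (auto simp: left_descents_def)
  fix s assume "s \<in> S - left_descents G S u"
  then have s: "s \<in> S" "\<not> s \<preceq> u" using gen_le_iff uvc by auto
  \<comment> \<open>For a gate above \<open>s\<close>, the suffix \<open>s \<otimes> y\<close> is a
    gate and can be carried from \<open>u\<close> to \<open>v\<close>.\<close>
  have step: "y \<preceq> s \<otimes> v"
    if y: "y \<in> ?\<Gamma>" "y \<preceq> s \<otimes> u" "s \<preceq> y" and uv: "same_part X u v" "\<not> s \<preceq> u" for y u v
  proof -
    have c: "y \<in> carrier G" "u \<in> carrier G" "v \<in> carrier G"
      using gates_subset[OF X] y uv by (auto simp: same_part_def)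
    have "len (s \<otimes> y) + 1 = len y" using y(3) s c by (simp add: right_weak_le_def)
    then have "is_suffix G S (s \<otimes> y) y"
      using s c by (simp add: is_suffix_def inv_mult_group)
    then have "s \<otimes> y \<in> ?\<Gamma>" using suffix y s c by simp
    moreover have "s \<otimes> y \<preceq> u" using gen_mult_le y s c uv by blast
    ultimately have "s \<otimes> y \<preceq> v" using same_part_gate_le[OF X] uv by blast
    moreover have "\<not> s \<preceq> v" using le_iff uv s by blast
    ultimately show ?thesis using gen_mult_le y s c by blast
  qed
  \<comment> \<open>The condition \<open>s \<preceq> y\<close> is removed by passing to the join of
    \<open>y\<close> and \<open>s\<close>, which is bounded by \<open>s \<otimes> u\<close>.\<close>
  have gate_le: "y \<preceq> s \<otimes> v"
    if y: "y \<in> ?\<Gamma>" "y \<preceq> s \<otimes> u" and uv: "same_part X u v" "\<not> s \<preceq> u" for y u v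
  proof -
    have c: "y \<in> carrier G" "u \<in> carrier G" "v \<in> carrier G"
      using gates_subset[OF X] y uv by (auto simp: same_part_def)
    have su: "s \<preceq> s \<otimes> u" using gen_le_mult_iff s c uv by blast
    have Y: "{y, s} \<subseteq> carrier G" "{y, s} \<subseteq> ?\<Gamma>" using c s y gen by auto
    have "\<exists>z. lub {y, s} z" by (rule lub_exists[OF Y(1), of "s \<otimes> u"]) (use su y c s in auto)
    then obtain z where z: "lub {y, s} z" ..
    have zc: "z \<in> carrier G" "y \<preceq> z" "s \<preceq> z" using z by (auto simp: lub_def)
    have "z \<preceq> s \<otimes> u" using z su y c s by (auto simp: lub_def)
    have "Upper (right_weak_order G S) {y, s} \<noteq> {}"
      using zc Upper_right_weak_order[OF Y(1)] by auto
    then have "z \<in> ?\<Gamma>" using sup[OF Y(2)] sup_right_weak_order[OF Y(1) z] by simp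
    then have "z \<preceq> s \<otimes> v" using step \<open>z \<preceq> s \<otimes> u\<close> zc uv by blast
    then show ?thesis using le_trans[OF zc(2)] zc c s by simp
  qed
  \<comment> \<open>Each \<open>x\<close> in \<open>X\<close> is a gate, being the greatest element
    of its own set. Fresh \<open>u\<close> and \<open>v\<close> allow use in both
    directions.\<close>
  have "x \<preceq> s \<otimes> v"
    if x: "x \<in> X" "x \<preceq> s \<otimes> u" and uv: "same_part X u v" "\<not> s \<preceq> u" for x u v
  proof -
    have c: "x \<in> carrier G" "u \<in> carrier G" "v \<in> carrier G" "s \<otimes> u \<in> carrier G"
      using X x uv s by (auto simp: same_part_def)
    have "x \<in> ?\<Gamma>" using gates_iff[OF X] x c by (auto simp: lub_def)
    then show ?thesis using gate_le x uv by blast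
  qed
  moreover have "\<not> s \<preceq> v" using le_iff uv s by blast
  ultimately show "same_part X (s \<otimes> u) (s \<otimes> v)"
    using uv same_part_sym[OF uv] s uvc unfolding same_part_def[of X "s \<otimes> u"] by auto
qed

lemma garside_shadow_if_regular:
  assumes X: "X \<subseteq> carrier G"
    and reg: "regular_partition G S (conical_partition G S X)"
  shows "garside_shadow G S (gates G S (conical_partition G S X))"
  unfolding garside_shadow_def
proof (intro conjI allI impI ballI)
  let ?\<Gamma> = "gates G S (conical_partition G S X)"
  have des: "s \<preceq> u \<longleftrightarrow> s \<preceq> v" if uv: "same_part X u v" and s: "s \<in> S" for s u v
  proof -
    have "u \<in> carrier G" "v \<in> carrier G" using uv by (simp_all add: same_part_def)
    then show ?thesis
      using reg[unfolded regular_conical_partition_iff, THEN spec, THEN spec, THEN mp, OF uv]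
        gen_le_iff[OF s] by simp
  qed
  show \<Gamma>: "?\<Gamma> \<subseteq> carrier G" using gates_subset[OF X] .
  show "S \<subseteq> ?\<Gamma>"
  proof
    fix s assume s: "s \<in> S"
    obtain g where g: "g \<in> ?\<Gamma>" "g \<preceq> s" "same_part X g s"
      using obtain_gate[OF X gen_closed[OF s]] .
    \<comment> \<open>Descents are constant on the part of \<open>s\<close>, so its gate lies above
      \<open>s\<close> as well as below it.\<close>
    have "s \<preceq> g" using des[OF g(3) s] s by simp
    then have "g = s" using g \<Gamma> s le_antisym by auto
    then show "s \<in> ?\<Gamma>" using g by simp
  qed
  fix Y assume Y: "Y \<subseteq> ?\<Gamma>" "Upper (right_weak_order G S) Y \<noteq> {}"
  have Yc: "Y \<subseteq> carrier G" using Y \<Gamma> by blast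
  obtain b where b: "b \<in> carrier G" "\<forall>y\<in>Y. y \<preceq> b"
    using Y(2) unfolding Upper_right_weak_order[OF Yc] by blast
  have "\<exists>j. lub Y j" by (rule lub_exists[OF Yc b(1)]) (use b(2) in blast)
  then obtain j where j: "lub Y j" ..
  then have jc: "j \<in> carrier G" by (simp add: lub_def)
  obtain g where g: "g \<in> ?\<Gamma>" "g \<preceq> j" "same_part X g j" using obtain_gate[OF X jc] .
  have gc: "g \<in> carrier G" using g \<Gamma> by blast
  \<comment> \<open>Gates below \<open>j\<close> are also below the gate \<open>g\<close> of its
    part. This makes \<open>g\<close> an upper bound of \<open>Y\<close>, hence equal to the
    join.\<close>
  have "y \<preceq> g" if "y \<in> Y" for y
    using same_part_gate_le[OF X _ same_part_sym[OF g(3)]] that j Y(1) by (auto simp: lub_def)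
  then have "j \<preceq> g" using j gc by (auto simp: lub_def)
  then have "g = j" using g gc jc le_antisym by blast
  then show "\<Squnion>\<^bsub>right_weak_order G S\<^esub> Y \<in> ?\<Gamma>" using sup_right_weak_order[OF Yc j] g by simp
next
  let ?\<Gamma> = "gates G S (conical_partition G S X)"
  have mult: "same_part X (s \<otimes> u) (s \<otimes> v)"
    if uv: "same_part X u v" and s: "s \<in> S" "\<not> s \<preceq> u" for s u v
  proof -
    have "u \<in> carrier G" using uv by (simp add: same_part_def)
    then show ?thesis
      using reg[unfolded regular_conical_partition_iff, THEN spec, THEN spec, THEN mp, OF uv]
        gen_le_iff[OF s(1)] s by simp
  qed
  fix w u assume "w \<in> ?\<Gamma>" "u \<in> carrier G" "is_suffix G S u w"
  have \<Gamma>: "?\<Gamma> \<subseteq> carrier G" using gates_subset[OF X] .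
  have step: "v \<in> ?\<Gamma>" if sv: "s \<otimes> v \<in> ?\<Gamma>" "len (s \<otimes> v) = len v + 1"
    "s \<in> S" "v \<in> carrier G" for s v
  proof -
    obtain g where g: "g \<in> ?\<Gamma>" "g \<preceq> v" "same_part X g v" using obtain_gate[OF X sv(4)] .
    have gc: "g \<in> carrier G" using g \<Gamma> by blast
    have "\<not> s \<preceq> v" using sv by (simp add: right_weak_le_def)
    then have "same_part X (s \<otimes> v) (s \<otimes> g)" using mult same_part_sym g sv by blast
    \<comment> \<open>The gate \<open>s \<otimes> v\<close> is below every member of its part;
      \<open>s \<otimes> g\<close> is one and is no longer, so the two agree.\<close>
    then have "s \<otimes> v \<preceq> s \<otimes> g" using same_part_gate_le[OF X sv(1)] sv by simp
    moreover have "len (s \<otimes> g) \<le> len (s \<otimes> v)"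
      using len_mult_le[of s g] le_len[OF g(2)] sv gc by simp
    ultimately have "s \<otimes> v = s \<otimes> g" using le_len_eq sv gc by simp
    then show ?thesis using sv gc g by simp
  qed
  \<comment> \<open>The letters of a reduced word for \<open>w \<otimes> inv u\<close> are stripped
    from the left one at a time.\<close>
  have "v \<in> ?\<Gamma>"
    if "p \<in> lists S" "v \<in> carrier G" "wp p \<otimes> v \<in> ?\<Gamma>" "len (wp p \<otimes> v) = length p + len v" for p v
    using that
  proof (induction p rule: list.induct)
    case (Cons s p)
    let ?v = "wp p \<otimes> v"
    have p: "s \<in> S" "p \<in> lists S" "v \<in> carrier G" "s \<otimes> ?v \<in> ?\<Gamma>"
      "len (s \<otimes> ?v) = length p + len v + 1"
      using Cons.prems by (auto simp: m_assoc)
    have "len ?v \<le> length p + len v" using len_mult_le[of "wp p" v] len_wp_le[of p] p by simp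
    moreover have "len (s \<otimes> ?v) \<le> len ?v + 1" using len_mult_le[of s ?v] p by simp
    \<comment> \<open>Each letter accounts for exactly one unit of length, so additivity passes to
      the remaining word.\<close>
    ultimately have l: "len ?v = length p + len v" using p by simp
    then have "?v \<in> ?\<Gamma>" using step[of s ?v] p by simp
    then show ?case using Cons.IH p l by blast
  qed simp
  moreover have wc: "w \<in> carrier G" using \<open>w \<in> ?\<Gamma>\<close> \<Gamma> by blast
  obtain p where p: "p \<in> lists S" "length p = len (w \<otimes> inv u)" "wp p = w \<otimes> inv u"
    using obtain_reduced_word[of "w \<otimes> inv u"] wc \<open>u \<in> carrier G\<close> by auto
  ultimately show "u \<in> ?\<Gamma>"
    using \<open>is_suffix G S u w\<close> \<open>u \<in> carrier G\<close> \<open>w \<in> ?\<Gamma>\<close> wc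
    by (simp add: is_suffix_def m_assoc)
qed

end

theorem corollary5p7:
  fixes G :: "('a, 'b) monoid_scheme" and S X :: "'a set"
  assumes "coxeter_system G S" and "finite S"
    and "X \<subseteq> carrier G" and "\<one>\<^bsub>G\<^esub> \<in> X"
  shows "garside_shadow G S (gates G S (conical_partition G S X)) \<longleftrightarrow>
    regular_partition G S (conical_partition G S X)"
  using coxeter_system.regular_if_garside_shadow[OF assms(1,3)]
    coxeter_system.garside_shadow_if_regular[OF assms(1,3)]
  by (rule iffI)

end
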